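(* Let $\alpha,\beta,c,d>0$ and $l\ge 0$ be real constants with $l\le \inf(\alpha,\beta)$. Then for any $(u_0,u_1)\in\mathbb{R}^2$, the equation $$\big(|u'|^{l}u'\big)'+c|u'|^{\alpha}u'+d|u|^{\beta}u=0$$ has a unique global solution $u$ on $\mathbb{R}^+$ satisfying $$u\in \mathcal{C}^1(\mathbb{R}^+),\qquad |u'|^{l}u'\in \mathcal{C}^1(\mathbb{R}^+),\qquad u(0)=u_0,\quad u'(0)=u_1.$$
   Context: $\mathbb{R}^+=[0,+\infty)$. A solution on an interval $J$ is a function $u\in\mathcal{C}^1(J)$ with $|u'|^lu'\in\mathcal{C}^1(J)$ which satisfies the equation at every point of $J$. *)

theory Defs
  imports "HOL-Analysis.Analysis"
begin

(* The derivative relative to J, so one-sided at an endpoint belonging to J. It is meaningful when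
   J is a nondegenerate interval: there the derivative within J is unique. The two-sided
   C1_differentiable_on would not do, since it constrains f outside J at such endpoints. *)
definition deriv_on :: "real set \<Rightarrow> (real \<Rightarrow> real) \<Rightarrow> real \<Rightarrow> real" where
  "deriv_on J f t = vector_derivative f (at t within J)"

definition C1_on :: "real set \<Rightarrow> (real \<Rightarrow> real) \<Rightarrow> bool" where
  "C1_on J f \<longleftrightarrow> f differentiable_on J \<and> continuous_on J (deriv_on J f)"

(* |x|^p x. The convention 0 powr 0 = 0 is harmless: for p = 0 the value at x = 0 is 0 anyway,
   so signed_pow 0 is the identity. *)
definition signed_pow :: "real \<Rightarrow> real \<Rightarrow> real" where
  "signed_pow p x = \<bar>x\<bar> powr p * x"

definition is_solution ::
  "real \<Rightarrow> real \<Rightarrow> real \<Rightarrow> real \<Rightarrow> real \<Rightarrow> real set \<Rightarrow> (real \<Rightarrow> real) \<Rightarrow> bool" where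
  "is_solution l \<alpha> \<beta> c d J u \<longleftrightarrow>
     C1_on J u \<and>
     C1_on J (\<lambda>t. signed_pow l (deriv_on J u t)) \<and>
     (\<forall>t\<in>J. deriv_on J (\<lambda>s. signed_pow l (deriv_on J u s)) t
             + c * signed_pow \<alpha> (deriv_on J u t) + d * signed_pow \<beta> (u t) = 0)"

(* A function on J is represented by a total function whose values outside J are irrelevant. *)
definition is_ivp_solution ::
  "real \<Rightarrow> real \<Rightarrow> real \<Rightarrow> real \<Rightarrow> real \<Rightarrow> real \<Rightarrow> real \<Rightarrow> (real \<Rightarrow> real) \<Rightarrow> bool" where
  "is_ivp_solution l \<alpha> \<beta> c d u0 u1 u \<longleftrightarrow>
     is_solution l \<alpha> \<beta> c d {0..} u \<and> u 0 = u0 \<and> deriv_on {0..} u 0 = u1"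

end

theory Submission
  imports Defs "HOL-Complex_Analysis.Great_Picard" "HOL-Real_Asymp.Real_Asymp"
begin

text \<open>
  With $v = |u'|^l u'$ and $q = 1/(l+1)$ the equation becomes the first-order system
  $u' = |v|^{q-1} v$, $v' = -c |v|^\gamma v - d |u|^\beta u$, whose right-hand side is locally
  Lipschitz except in $v$ at $v = 0$, where the first component is only Hoelder continuous.

  Existence: the right-hand side, truncated to a large box, is bounded and continuous, so Peano's
  theorem gives solutions on every $[0,T]$. The energy
  $|v|^{q+1}/(q+1) + d |u|^{\beta+2}/(\beta+2)$ decreases, so the box is never left.

  Uniqueness forward from a time $a$: if $u(a) = v(a) = 0$, the energy stays $0$. Otherwise
  $|v(t)| \ge m (t-a)$ just after $a$, since $v'(a) \ne 0$ when $v(a) = 0$. Hence the Lipschitz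
  constant of $|v|^{q-1} v$ along solutions is $O((t-a)^{q-1})$, which is integrable, and a Gronwall
  argument applies.
\<close>

section \<open>Signed powers: algebra, continuity, derivatives and Lipschitz bounds\<close>

lemma signed_pow_0 [simp]: "signed_pow p 0 = 0"
  by (simp add: signed_pow_def)

lemma signed_pow_exponent_0 [simp]: "signed_pow 0 x = x"
  by (simp add: signed_pow_def)

lemma signed_pow_minus: "signed_pow p (- x) = - signed_pow p x"
  by (simp add: signed_pow_def)

lemma signed_pow_eq_0_iff [simp]: "signed_pow p x = 0 \<longleftrightarrow> x = 0"
  by (auto simp: signed_pow_def)

lemma signed_pow_pos: "x > 0 \<Longrightarrow> signed_pow p x = x powr (p + 1)"
  by (simp add: signed_pow_def powr_add)

lemma abs_signed_pow: "\<bar>signed_pow p x\<bar> = \<bar>x\<bar> powr (p + 1)"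
  by (simp add: signed_pow_def abs_mult powr_add)

text \<open>On positive numbers \<open>signed_pow p\<close> is the power of exponent
  \<open>p + 1\<close>, and these exponents multiply under composition. Hence
  \<open>signed_pow l\<close> and \<open>signed_pow (q - 1)\<close> are mutually inverse as soon as
  \<open>q * (l + 1) = 1\<close>.\<close>

lemma signed_pow_signed_pow:
  "signed_pow p (signed_pow q x) = signed_pow ((p + 1) * (q + 1) - 1) x"
proof -
  have "signed_pow p (signed_pow q x) = (\<bar>x\<bar> powr ((q + 1) * p) * \<bar>x\<bar> powr q) * x"
    by (subst signed_pow_def) (simp add: abs_signed_pow powr_powr, simp add: signed_pow_def)
  also have "\<dots> = \<bar>x\<bar> powr ((q + 1) * p + q) * x"
    by (simp add: powr_add)
  also have "(q + 1) * p + q = (p + 1) * (q + 1) - 1"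
    by (simp add: algebra_simps)
  finally show ?thesis
    by (simp add: signed_pow_def)
qed

text \<open>The range \<open>p > -1\<close> covers the exponent \<open>q - 1\<close>, which is
  negative when \<open>q < 1\<close>. At 0 the absolute value of the function is a positive power of
  \<open>\<bar>x\<bar>\<close>, hence tends to 0.\<close>

lemma isCont_signed_pow:
  assumes "p > -1"
  shows "isCont (signed_pow p) x"
proof (cases "x = 0")
  case True
  have "((\<lambda>x. \<bar>x\<bar> powr (p + 1)) \<longlongrightarrow> 0) (at (0::real))"
    using assms by (intro tendsto_zero_powrI) (auto intro!: tendsto_eq_intros)
  then have "((\<lambda>x. \<bar>signed_pow p x\<bar>) \<longlongrightarrow> 0) (at 0)"
    by (simp add: abs_signed_pow)
  then show ?thesis
    using True by (simp add: isCont_def tendsto_rabs_zero_iff)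
next
  case False
  then show ?thesis
    unfolding signed_pow_def by (intro continuous_intros) auto
qed

lemma continuous_on_signed_pow [continuous_intros]:
  assumes "continuous_on S f" "p > -1"
  shows "continuous_on S (\<lambda>x. signed_pow p (f x))"
  using continuous_on_compose2[of UNIV "signed_pow p" S f] isCont_signed_pow[OF assms(2)] assms(1)
  by (simp add: continuous_at_imp_continuous_on)

text \<open>Serves to differentiate both terms of the energy, with \<open>r = q + 1\<close> and
  \<open>r = \<beta> + 2\<close>.\<close>

lemma DERIV_abs_powr:
  assumes "r > 1"
  shows "((\<lambda>x. \<bar>x\<bar> powr r) has_real_derivative r * signed_pow (r - 2) x) (at x)"
proof -
  have pos: "((\<lambda>x. \<bar>x\<bar> powr r) has_real_derivative r * signed_pow (r - 2) y) (at y)"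
    if "y > 0" for y
  proof (rule DERIV_cong_ev[THEN iffD1])
    show "\<forall>\<^sub>F x in nhds y. x powr r = \<bar>x\<bar> powr r"
      using eventually_nhds_in_open[of "{0<..}" y] that by (auto elim!: eventually_mono)
    show "((\<lambda>x. x powr r) has_real_derivative r * y powr (r - 1)) (at y)"
      by (rule has_real_derivative_powr[OF that])
  qed (use that in \<open>simp_all add: signed_pow_pos\<close>)
  show ?thesis
  proof (cases x "0::real" rule: linorder_cases)
    case equal
    \<comment> \<open>Caratheodory's criterion at 0: the slope function is
      \<open>signed_pow (r - 2)\<close>, continuous there because \<open>r - 2 > -1\<close>.\<close>
    have "\<bar>z\<bar> powr r = signed_pow (r - 2) z * z" for z
    proof -
      have "\<bar>z\<bar> powr r = \<bar>z\<bar> powr (r - 2) * \<bar>z\<bar> powr 2"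
        using powr_add[of "\<bar>z\<bar>" "r - 2" 2] by simp
      also have "\<bar>z\<bar> powr 2 = z * z"
        by (cases "z = 0") (auto simp: powr_numeral power2_eq_square)
      finally show ?thesis
        by (simp add: signed_pow_def)
    qed
    then show ?thesis
      using equal isCont_signed_pow[of "r - 2" 0] assms
      by (intro iffD2[OF CARAT_DERIV]) (auto intro!: exI[of _ "\<lambda>z. signed_pow (r - 2) z"] isCont_mult)
  next
    case less
    have "((\<lambda>x. \<bar>- x\<bar> powr r) has_real_derivative r * signed_pow (r - 2) (- x) * (- 1)) (at x)"
      using less by (intro DERIV_chain2[OF pos]) (auto intro!: derivative_eq_intros)
    then show ?thesis
      by (simp add: signed_pow_minus)
  qed (use pos in auto)
qed

lemma DERIV_signed_pow:
  assumes "p > 0"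
  shows "(signed_pow p has_real_derivative (p + 1) * \<bar>x\<bar> powr p) (at x)"
proof -
  have pos: "(signed_pow p has_real_derivative (p + 1) * \<bar>y\<bar> powr p) (at y)" if "y > 0" for y
  proof (rule DERIV_cong_ev[THEN iffD1])
    show "\<forall>\<^sub>F x in nhds y. x powr (p + 1) = signed_pow p x"
      using eventually_nhds_in_open[of "{0<..}" y] that
      by (auto elim!: eventually_mono simp: signed_pow_pos)
    show "((\<lambda>x. x powr (p + 1)) has_real_derivative (p + 1) * y powr (p + 1 - 1)) (at y)"
      by (rule has_real_derivative_powr[OF that])
  qed (use that in simp_all)
  show ?thesis
  proof (cases x "0::real" rule: linorder_cases)
    case equal
    have "isCont (\<lambda>z. \<bar>z\<bar> powr p) (0::real)"
      using assms unfolding isCont_def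
      by (auto intro!: tendsto_zero_powrI tendsto_eq_intros)
    then show ?thesis
      using equal assms
      by (intro iffD2[OF CARAT_DERIV]) (auto intro!: exI[of _ "\<lambda>z. \<bar>z\<bar> powr p"] simp: signed_pow_def)
  next
    case less
    have "((\<lambda>x. - signed_pow p (- x)) has_real_derivative - ((p + 1) * \<bar>- x\<bar> powr p * (- 1))) (at x)"
      using less by (intro DERIV_minus DERIV_chain2[OF pos]) (auto intro!: derivative_eq_intros)
    then show ?thesis
      by (simp add: signed_pow_minus)
  qed (use pos in auto)
qed

text \<open>Mean value theorem on \<open>{-R..R}\<close>, where the derivative
  \<open>(p + 1) * \<bar>z\<bar> powr p\<close> is largest for
  \<open>\<bar>z\<bar> = R\<close>.\<close>

lemma signed_pow_lipschitz:
  assumes "p \<ge> 0"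
  obtains L where "L \<ge> 0" "\<And>x y. \<bar>x\<bar> \<le> R \<Longrightarrow> \<bar>y\<bar> \<le> R \<Longrightarrow> \<bar>signed_pow p x - signed_pow p y\<bar> \<le> L * \<bar>x - y\<bar>"
proof (cases "p = 0")
  case True
  then show ?thesis
    using that[of 1] by simp
next
  case False
  have "\<bar>signed_pow p x - signed_pow p y\<bar> \<le> ((p + 1) * R powr p) * \<bar>x - y\<bar>"
    if "\<bar>x\<bar> \<le> R" "\<bar>y\<bar> \<le> R" for x y
    unfolding real_norm_def[symmetric]
  proof (rule field_differentiable_bound)
    show "(signed_pow p has_field_derivative (p + 1) * \<bar>z\<bar> powr p) (at z within {-R..R})" for z
      using DERIV_signed_pow[of p z] False assms(1) by (auto intro: has_field_derivative_at_within)
    show "norm ((p + 1) * \<bar>z\<bar> powr p) \<le> (p + 1) * R powr p" if "z \<in> {-R..R}" for z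
      using that assms(1) by (auto intro!: mult_left_mono powr_mono2)
  qed (use that in auto)
  then show ?thesis
    using that[of "(p + 1) * R powr p"] assms(1) by simp
qed

text \<open>Since \<open>q \<le> 1\<close>, the derivative of \<open>x powr q\<close> is
  nonincreasing, so on \<open>{s..}\<close> it is largest at \<open>s\<close>. For
  \<open>q < 1\<close> the constant blows up as \<open>s\<close> tends to 0, which is the difficulty
  in the uniqueness proof.\<close>

lemma powr_diff_le:
  fixes q s x y :: real
  assumes "0 < q" "q \<le> 1" "0 < s" "s \<le> x" "s \<le> y"
  shows "\<bar>x powr q - y powr q\<bar> \<le> q * s powr (q - 1) * \<bar>x - y\<bar>"
  unfolding real_norm_def[symmetric]
proof (rule field_differentiable_bound)
  show "((\<lambda>x. x powr q) has_field_derivative q * z powr (q - 1)) (at z within {s..})"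
    if "z \<in> {s..}" for z
    using has_real_derivative_powr[of z q] that assms by (auto intro: has_field_derivative_at_within)
  show "norm (q * z powr (q - 1)) \<le> q * s powr (q - 1)" if "z \<in> {s..}" for z
    using that assms by (auto intro!: mult_left_mono powr_mono2')
qed (use assms in auto)

section \<open>Peano's existence theorem for bounded continuous vector fields\<close>

text \<open>
  Tonelli's scheme: because of the delay $h$ the iterates become stationary on $[0, kh]$ after $k$
  steps, so they solve the delayed integral equation exactly. The \<^term>\<open>max\<close> extends the solution
  by its initial value to negative times.
\<close>

primrec delayed_iterate :: "('a::banach \<Rightarrow> 'a) \<Rightarrow> 'a \<Rightarrow> real \<Rightarrow> nat \<Rightarrow> real \<Rightarrow> 'a" where
  "delayed_iterate F x0 h 0 = (\<lambda>t. x0)"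
| "delayed_iterate F x0 h (Suc k) =
     (\<lambda>t. x0 + integral {0..t} (\<lambda>s. F (delayed_iterate F x0 h k (max 0 (s - h)))))"

text \<open>The integrand is bounded by \<open>B\<close>. The constant depends neither on
  \<open>h\<close> nor on \<open>k\<close>, which later supplies the equicontinuity for
  Arzela-Ascoli.\<close>

lemma delayed_iterate_lipschitz:
  fixes F :: "'a::banach \<Rightarrow> 'a"
  assumes F: "continuous_on UNIV F" and B: "\<And>x. norm (F x) \<le> B" and "h \<ge> 0"
  shows "B-lipschitz_on {0..} (delayed_iterate F x0 h k)"
proof (induction k)
  case 0
  have "B \<ge> 0"
    using B[of 0] norm_ge_zero order_trans by blast
  then show ?case
    by (auto intro: lipschitz_onI)
next
  case (Suc k)
  let ?f = "\<lambda>s. F (delayed_iterate F x0 h k (max 0 (s - h)))"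
  have cont: "continuous_on A ?f" for A
    by (intro continuous_on_compose2[OF F] continuous_on_compose2[OF lipschitz_on_continuous_on[OF Suc.IH]]
        continuous_intros) auto
  have *: "norm (delayed_iterate F x0 h (Suc k) t - delayed_iterate F x0 h (Suc k) s) \<le> B * (t - s)"
    if "0 \<le> s" "s \<le> t" for s t
  proof -
    have "integral {0..t} ?f = integral {0..s} ?f + integral {s..t} ?f"
      using that cont by (intro Henstock_Kurzweil_Integration.integral_combine[symmetric] integrable_continuous_real) auto
    then have "delayed_iterate F x0 h (Suc k) t - delayed_iterate F x0 h (Suc k) s = integral {s..t} ?f"
      by simp
    then show ?thesis
      using integral_bound[OF that(2) cont] B by metis
  qed
  show ?case
  proof (rule lipschitz_onI)
    show "B \<ge> 0"
      using B[of 0] norm_ge_zero order_trans by blast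
    fix s t :: real
    assume "s \<in> {0..}" "t \<in> {0..}"
    then show "dist (delayed_iterate F x0 h (Suc k) s) (delayed_iterate F x0 h (Suc k) t) \<le> B * dist s t"
      using *[of s t] *[of t s]
      by (cases "s \<le> t") (auto simp: dist_norm norm_minus_commute simp del: delayed_iterate.simps)
  qed
qed

text \<open>An iterate at time \<open>t\<close> reads its predecessor only at times
  \<open>max 0 (s - h)\<close> with \<open>s \<le> t\<close>, so agreement on
  \<open>[0, k * h]\<close> propagates to \<open>[0, (k + 1) * h]\<close>.\<close>

lemma delayed_iterate_Suc_eq:
  assumes "0 \<le> t" "t \<le> real k * h" "h \<ge> 0"
  shows "delayed_iterate F x0 h (Suc k) t = delayed_iterate F x0 h k t"
  using assms(1,2)
proof (induction k arbitrary: t)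
  case (Suc k)
  have "delayed_iterate F x0 h (Suc k) (max 0 (s - h)) = delayed_iterate F x0 h k (max 0 (s - h))"
    if "s \<in> {0..t}" for s
    using that Suc.prems assms(3) by (intro Suc.IH) (auto simp: algebra_simps)
  then show ?case
    by (subst (1 2) delayed_iterate.simps) (auto intro!: integral_cong simp del: delayed_iterate.simps)
qed auto

lemma ex_delayed_solution:
  fixes F :: "'a::banach \<Rightarrow> 'a" and T :: real
  assumes F: "continuous_on UNIV F" and B: "\<And>x. norm (F x) \<le> B" and "h > 0"
  shows "\<exists>x. B-lipschitz_on {0..} x \<and>
    (\<forall>t\<in>{0..T}. x t = x0 + integral {0..t} (\<lambda>s. F (x (max 0 (s - h)))))"
proof -
  obtain N :: nat where "T / h \<le> real N"
    using real_arch_simple by blast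
  then have N: "T \<le> real N * h"
    using assms by (simp add: field_simps)
  show ?thesis
  proof (intro exI conjI ballI)
    show "B-lipschitz_on {0..} (delayed_iterate F x0 h N)"
      using assms by (intro delayed_iterate_lipschitz) auto
    fix t assume "t \<in> {0..T}"
    then show "delayed_iterate F x0 h N t =
        x0 + integral {0..t} (\<lambda>s. F (delayed_iterate F x0 h N (max 0 (s - h))))"
      using delayed_iterate_Suc_eq[of t N h F x0] N assms by simp
  qed
qed

text \<open>Solutions with delay \<open>1 / (n + 1)\<close> share a Lipschitz constant and a bound
  on \<open>{0..T}\<close>. A uniform limit along a subsequence solves the integral equation without
  delay, by dominated convergence.\<close>

theorem peano_bounded:
  fixes F :: "'a::euclidean_space \<Rightarrow> 'a"
  assumes F: "continuous_on UNIV F" and B: "\<And>x. norm (F x) \<le> B" and T: "T \<ge> 0"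
  obtains x where "x 0 = x0"
    "\<And>t. t \<in> {0..T} \<Longrightarrow> (x has_vector_derivative F (x t)) (at t within {0..T})"
proof -
  have "\<forall>n. \<exists>x. B-lipschitz_on {0..} x \<and>
    (\<forall>t\<in>{0..T}. x t = x0 + integral {0..t} (\<lambda>s. F (x (max 0 (s - 1 / real (Suc n))))))"
    by (intro allI ex_delayed_solution[OF F B]) simp
  then obtain X where lip: "\<And>n. B-lipschitz_on {0..} (X n)"
    and X: "\<And>n t. t \<in> {0..T} \<Longrightarrow> X n t = x0 + integral {0..t} (\<lambda>s. F (X n (max 0 (s - 1 / real (Suc n)))))"
    by metis
  have B0: "B \<ge> 0"
    using B[of 0] norm_ge_zero order_trans by blast
  have lip': "norm (X n s - X n t) \<le> B * \<bar>s - t\<bar>" if "0 \<le> s" "0 \<le> t" for n s t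
    using lipschitz_onD[OF lip, of s t] that by (simp add: dist_norm)
  have X0: "X n 0 = x0" for n
    using X[of 0 n] T by simp
  have bd: "norm (X n t) \<le> norm x0 + B * T" if "t \<in> {0..T}" for n t
  proof -
    have "norm (X n t) \<le> norm x0 + norm (X n t - x0)"
      by (metis norm_triangle_sub)
    moreover have "norm (X n t - x0) \<le> B * t"
      using lip'[of t 0 n] that by (simp add: X0)
    moreover have "B * t \<le> B * T"
      using that B0 by (intro mult_left_mono) auto
    ultimately show ?thesis by linarith
  qed
  obtain g k where g: "continuous_on {0..T} g" "strict_mono (k :: nat \<Rightarrow> nat)"
    and lim: "\<And>e. 0 < e \<Longrightarrow> \<exists>N. \<forall>n x. n \<ge> N \<and> x \<in> {0..T} \<longrightarrow> norm (X (k n) x - g x) < e"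
  proof (rule Arzela_Ascoli[of "{0..T}" X "norm x0 + B * T"])
    fix x e :: real
    assume "x \<in> {0..T}" "0 < e"
    \<comment> \<open>The denominator is \<open>B + 1\<close> because \<open>B\<close> may be
      0.\<close>
    then have "\<forall>n y. y \<in> {0..T} \<and> norm (x - y) < e / (B + 1) \<longrightarrow> norm (X n x - X n y) < e"
    proof (intro allI impI)
      fix n y assume y: "y \<in> {0..T} \<and> norm (x - y) < e / (B + 1)"
      have "norm (X n x - X n y) \<le> B * \<bar>x - y\<bar>"
        using y \<open>x \<in> _\<close> by (intro lip') auto
      also have "\<dots> \<le> (B + 1) * \<bar>x - y\<bar>"
        by (simp add: mult_right_mono)
      also have "\<dots> < e"
        using y B0 by (simp add: field_simps)
      finally show "norm (X n x - X n y) < e" .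
    qed
    then show "\<exists>d. 0 < d \<and> (\<forall>n y. y \<in> {0..T} \<and> norm (x - y) < d \<longrightarrow> norm (X n x - X n y) < e)"
      using \<open>0 < e\<close> B0 by (intro exI[of _ "e / (B + 1)"]) auto
  qed (use bd in auto)
  have conv: "(\<lambda>n. X (k n) t) \<longlonglongrightarrow> g t" if "t \<in> {0..T}" for t
    unfolding LIMSEQ_iff using lim that by meson
  have k: "filterlim k at_top sequentially"
    using g(2) by (rule filterlim_subseq)
  \<comment> \<open>The delay moves the argument by at most \<open>1 / (k n + 1)\<close>, so the
    common Lipschitz constant makes its effect vanish in the limit.\<close>
  have delay: "(\<lambda>n. X (k n) (max 0 (s - 1 / real (Suc (k n))))) \<longlonglongrightarrow> g s" if "s \<in> {0..T}" for s
  proof -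
    have "(\<lambda>n. X (k n) (max 0 (s - 1 / real (Suc (k n)))) - X (k n) s) \<longlonglongrightarrow> 0"
    proof (rule Lim_null_comparison)
      show "\<forall>\<^sub>F n in sequentially. norm (X (k n) (max 0 (s - 1 / real (Suc (k n)))) - X (k n) s)
          \<le> B * (1 / real (Suc (k n)))"
      proof (rule always_eventually, rule allI)
        fix n
        have "norm (X (k n) (max 0 (s - 1 / real (Suc (k n)))) - X (k n) s)
            \<le> B * \<bar>max 0 (s - 1 / real (Suc (k n))) - s\<bar>"
          using that by (intro lip') auto
        also have "\<dots> \<le> B * (1 / real (Suc (k n)))"
          using that B0 by (intro mult_left_mono) (auto simp: max_def)
        finally show "norm (X (k n) (max 0 (s - 1 / real (Suc (k n)))) - X (k n) s)
          \<le> B * (1 / real (Suc (k n)))" .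
      qed
      have "(\<lambda>n. 1 / real (Suc (k n))) \<longlonglongrightarrow> 0"
        using filterlim_compose[OF lim_inverse_n'[THEN LIMSEQ_Suc] k] by simp
      then show "(\<lambda>n. B * (1 / real (Suc (k n)))) \<longlonglongrightarrow> 0"
        using tendsto_mult_right_zero by blast
    qed
    from tendsto_add[OF this conv[OF that]] show ?thesis by simp
  qed
  have eq: "g t = x0 + integral {0..t} (\<lambda>s. F (g s))" if t: "t \<in> {0..T}" for t
  proof -
    have "(\<lambda>n. integral {0..t} (\<lambda>s. F (X (k n) (max 0 (s - 1 / real (Suc (k n)))))))
        \<longlonglongrightarrow> integral {0..t} (\<lambda>s. F (g s))"
    proof (rule dominated_convergence(2)[where h = "\<lambda>_. B"])
      show "(\<lambda>s. F (X (k n) (max 0 (s - 1 / real (Suc (k n)))))) integrable_on {0..t}" for n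
        by (intro integrable_continuous_real continuous_on_compose2[OF F]
            continuous_on_compose2[OF lipschitz_on_continuous_on[OF lip]] continuous_intros) auto
      show "(\<lambda>n. F (X (k n) (max 0 (s - 1 / real (Suc (k n)))))) \<longlonglongrightarrow> F (g s)" if "s \<in> {0..t}" for s
        using delay[of s] that t F
        by (intro isCont_tendsto_compose[of _ F]) (auto simp: continuous_on_eq_continuous_at)
    qed (use B in auto)
    then have "(\<lambda>n. X (k n) t) \<longlonglongrightarrow> x0 + integral {0..t} (\<lambda>s. F (g s))"
      using X[OF t] by (auto intro: tendsto_add)
    with conv[OF t] show ?thesis
      using LIMSEQ_unique by blast
  qed
  show ?thesis
  proof (rule that[of g])
    show "g 0 = x0"
      using eq[of 0] T by simp
    fix t assume t: "t \<in> {0..T}"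
    have "continuous_on {0..T} (\<lambda>s. F (g s))"
      by (intro continuous_on_compose2[OF F] g(1)) auto
    from integral_has_vector_derivative[OF this t]
    have D: "((\<lambda>u. x0 + integral {0..u} (\<lambda>s. F (g s))) has_vector_derivative F (g t)) (at t within {0..T})"
      using has_vector_derivative_add[OF has_vector_derivative_const[of x0]] by fastforce
    show "(g has_vector_derivative F (g t)) (at t within {0..T})"
      by (rule has_vector_derivative_transform[OF t _ D]) (rule eq)
  qed
qed

section \<open>The first-order system and its energy\<close>

locale damped_system =
  fixes q \<gamma> \<beta> c d :: real
  assumes q: "0 < q" "q \<le> 1" and \<gamma>: "0 \<le> \<gamma>" and \<beta>: "0 < \<beta>" and c: "0 < c" and d: "0 < d"
begin

definition accel :: "real \<Rightarrow> real \<Rightarrow> real" where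
  "accel x y = - c * signed_pow \<gamma> y - d * signed_pow \<beta> x"

text \<open>Derivatives are taken within \<open>S\<close>, hence one-sided at endpoints, so that
  restriction to a subset and gluing of intervals are direct.\<close>

definition solves :: "real set \<Rightarrow> (real \<Rightarrow> real) \<Rightarrow> (real \<Rightarrow> real) \<Rightarrow> bool" where
  "solves S u v \<longleftrightarrow> (\<forall>t\<in>S.
     (u has_real_derivative signed_pow (q - 1) (v t)) (at t within S) \<and>
     (v has_real_derivative accel (u t) (v t)) (at t within S))"

text \<open>For \<open>q = 1 / (l + 1)\<close> and \<open>y = |u'|^l u'\<close> the first term is
  \<open>(l + 1) / (l + 2) * |u'|^(l + 2)\<close>, the kinetic energy. The second is the potential
  of the restoring force \<open>d * signed_pow \<beta> x\<close>.\<close>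

definition energy :: "real \<Rightarrow> real \<Rightarrow> real" where
  "energy x y = \<bar>y\<bar> powr (q + 1) / (q + 1) + d * \<bar>x\<bar> powr (\<beta> + 2) / (\<beta> + 2)"

lemma solves_subset: "solves S u v \<Longrightarrow> T \<subseteq> S \<Longrightarrow> solves T u v"
  unfolding solves_def by (meson DERIV_subset subsetD)

lemma solves_imp_continuous_on:
  assumes "solves S u v"
  shows "continuous_on S u" "continuous_on S v"
proof -
  show "continuous_on S u"
    by (rule DERIV_continuous_on[where D = "\<lambda>t. signed_pow (q - 1) (v t)"])
      (use assms in \<open>simp add: solves_def\<close>)
  show "continuous_on S v"
    by (rule DERIV_continuous_on[where D = "\<lambda>t. accel (u t) (v t)"])
      (use assms in \<open>simp add: solves_def\<close>)
qed

lemma solves_DERIV: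
  assumes "solves {a..b} u v" "a < t" "t < b"
  shows "DERIV u t :> signed_pow (q - 1) (v t)" "DERIV v t :> accel (u t) (v t)"
proof -
  have "at t within {a..b} = at t" "t \<in> {a..b}"
    using assms(2,3) by (auto intro: at_within_Icc_at)
  then show "DERIV u t :> signed_pow (q - 1) (v t)" "DERIV v t :> accel (u t) (v t)"
    using assms(1) unfolding solves_def by metis+
qed

lemma energy_eq_0_iff: "energy x y = 0 \<longleftrightarrow> x = 0 \<and> y = 0"
proof -
  have "\<bar>y\<bar> powr (q + 1) / (q + 1) \<ge> 0" "d * \<bar>x\<bar> powr (\<beta> + 2) / (\<beta> + 2) \<ge> 0"
    using q \<beta> d by auto
  then have "energy x y = 0 \<longleftrightarrow>
      \<bar>y\<bar> powr (q + 1) / (q + 1) = 0 \<and> d * \<bar>x\<bar> powr (\<beta> + 2) / (\<beta> + 2) = 0"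
    unfolding energy_def by linarith
  then show ?thesis
    using q \<beta> d by auto
qed

lemma energy_nonneg: "energy x y \<ge> 0"
  using q \<beta> d by (simp add: energy_def)

text \<open>The restoring force cancels against the potential term. What remains is
  \<open>- c\<close> times a product of two signed powers of \<open>v t\<close>, which have the same
  sign. The equations are required at interior times only, so the lemma also applies to a truncated
  system up to its first exit from the box.\<close>

lemma energy_decreasing:
  assumes "a \<le> b" and cont: "continuous_on {a..b} u" "continuous_on {a..b} v"
    and u: "\<And>t. a < t \<Longrightarrow> t < b \<Longrightarrow> DERIV u t :> signed_pow (q - 1) (v t)"
    and v: "\<And>t. a < t \<Longrightarrow> t < b \<Longrightarrow> DERIV v t :> accel (u t) (v t)"
  shows "energy (u b) (v b) \<le> energy (u a) (v a)"
proof (rule DERIV_nonpos_imp_decreasing_open[OF \<open>a \<le> b\<close>])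
  fix t assume t: "a < t" "t < b"
  have dv: "((\<lambda>t. \<bar>v t\<bar> powr (q + 1)) has_real_derivative
      (q + 1) * signed_pow (q - 1) (v t) * accel (u t) (v t)) (at t)"
    using DERIV_chain2[OF DERIV_abs_powr[of "q + 1"] v[OF t]] q by simp
  have du: "((\<lambda>t. \<bar>u t\<bar> powr (\<beta> + 2)) has_real_derivative
      (\<beta> + 2) * signed_pow \<beta> (u t) * signed_pow (q - 1) (v t)) (at t)"
    using DERIV_chain2[OF DERIV_abs_powr[of "\<beta> + 2"] u[OF t]] \<beta> by simp
  have "((\<lambda>t. energy (u t) (v t)) has_real_derivative
      (q + 1) * signed_pow (q - 1) (v t) * accel (u t) (v t) / (q + 1) +
      d * ((\<beta> + 2) * signed_pow \<beta> (u t) * signed_pow (q - 1) (v t)) / (\<beta> + 2)) (at t)"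
    unfolding energy_def by (intro DERIV_add DERIV_cdivide DERIV_cmult du dv)
  moreover have "(q + 1) * signed_pow (q - 1) (v t) * accel (u t) (v t) / (q + 1) +
      d * ((\<beta> + 2) * signed_pow \<beta> (u t) * signed_pow (q - 1) (v t)) / (\<beta> + 2) =
      - c * (signed_pow (q - 1) (v t) * signed_pow \<gamma> (v t))"
  proof -
    have "(q + 1) * signed_pow (q - 1) (v t) * accel (u t) (v t) / (q + 1) = signed_pow (q - 1) (v t) * accel (u t) (v t)"
      "d * ((\<beta> + 2) * signed_pow \<beta> (u t) * signed_pow (q - 1) (v t)) / (\<beta> + 2) =
        d * signed_pow \<beta> (u t) * signed_pow (q - 1) (v t)"
      using q \<beta> by auto
    then show ?thesis
      by (simp add: accel_def algebra_simps)
  qed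
  moreover have "signed_pow (q - 1) (v t) * signed_pow \<gamma> (v t) \<ge> 0"
  proof -
    have "signed_pow (q - 1) (v t) * signed_pow \<gamma> (v t) = \<bar>v t\<bar> powr (q - 1) * \<bar>v t\<bar> powr \<gamma> * (v t * v t)"
      by (simp add: signed_pow_def)
    also have "\<dots> \<ge> 0"
      by (rule mult_nonneg_nonneg[OF mult_nonneg_nonneg[OF powr_ge_zero powr_ge_zero] zero_le_square])
    finally show ?thesis .
  qed
  ultimately show "\<exists>y. ((\<lambda>t. energy (u t) (v t)) has_real_derivative y) (at t) \<and> y \<le> 0"
    using c by (auto intro!: exI)
next
  show "continuous_on {a..b} (\<lambda>t. energy (u t) (v t))"
    unfolding energy_def using q \<beta>
    by (intro continuous_on_add continuous_on_divide continuous_on_mult continuous_on_powr'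
        continuous_on_const continuous_on_rabs cont) auto
qed

section \<open>Forward uniqueness\<close>

text \<open>Here \<open>\<sigma>\<close> is the common sign of \<open>x\<close> and
  \<open>y\<close>. Multiplying by it reduces the claim to positive arguments, where
  \<open>powr_diff_le\<close> applies.\<close>

lemma signed_pow_diff_le:
  assumes "\<bar>\<sigma>\<bar> = 1" "0 < s" "s \<le> \<sigma> * x" "s \<le> \<sigma> * y"
  shows "\<bar>signed_pow (q - 1) x - signed_pow (q - 1) y\<bar> \<le> q * s powr (q - 1) * \<bar>x - y\<bar>"
proof -
  have "signed_pow (q - 1) z = \<sigma> * (\<sigma> * z) powr q" if "s \<le> \<sigma> * z" for z
  proof -
    have "\<sigma> = 1 \<or> \<sigma> = -1"
      using assms(1) by linarith
    then show ?thesis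
      using signed_pow_pos[of "\<sigma> * z" "q - 1"] signed_pow_minus[of "q - 1" z] that assms(2) by auto
  qed
  then have "\<bar>signed_pow (q - 1) x - signed_pow (q - 1) y\<bar> = \<bar>\<sigma>\<bar> * \<bar>(\<sigma> * x) powr q - (\<sigma> * y) powr q\<bar>"
    using assms by (simp add: abs_mult flip: right_diff_distrib)
  also have "\<dots> \<le> q * s powr (q - 1) * \<bar>\<sigma> * x - \<sigma> * y\<bar>"
    using powr_diff_le[of q s "\<sigma> * x" "\<sigma> * y"] q assms by simp
  also have "\<bar>\<sigma> * x - \<sigma> * y\<bar> = \<bar>x - y\<bar>"
    using assms(1) by (simp add: abs_mult flip: right_diff_distrib)
  finally show ?thesis .
qed

text \<open>The sign of the velocity just after a time with state \<^term>\<open>(x, y)\<close>.\<close>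

definition direction :: "real \<Rightarrow> real \<Rightarrow> real" where
  "direction x y = (if y = 0 then - sgn x else sgn y)"

text \<open>If \<open>v a \<noteq> 0\<close>, continuity keeps \<open>v\<close> away from 0. If
  \<open>v a = 0\<close>, then \<open>u a \<noteq> 0\<close> and \<open>v\<close> has the nonzero
  derivative \<open>- d * signed_pow \<beta> (u a)\<close> at \<open>a\<close>, so it leaves 0 at a
  linear rate.\<close>

lemma velocity_lower_bound:
  assumes sol: "solves {a..b} u v" and "a < b" and nz: "u a \<noteq> 0 \<or> v a \<noteq> 0"
  obtains m \<delta> where "m > 0" "\<delta> > 0"
    "\<And>t. t \<in> {a..b} \<Longrightarrow> t \<le> a + \<delta> \<Longrightarrow> m * (t - a) \<le> direction (u a) (v a) * v t"
proof (cases "v a = 0")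
  case False
  let ?m = "\<bar>v a\<bar> / 2"
  have lim: "((\<lambda>t. sgn (v a) * v t) \<longlongrightarrow> sgn (v a) * v a) (at a within {a..b})"
    using solves_imp_continuous_on(2)[OF sol] \<open>a < b\<close>
    by (intro tendsto_intros) (auto simp: continuous_on_def)
  have "\<forall>\<^sub>F t in at a within {a..b}. ?m < sgn (v a) * v t"
    by (rule order_tendstoD(1)[OF lim]) (use False in \<open>auto simp: sgn_if\<close>)
  then obtain e where e: "e > 0" "\<And>t. t \<in> {a..b} \<Longrightarrow> t \<noteq> a \<Longrightarrow> dist t a < e \<Longrightarrow> ?m < sgn (v a) * v t"
    unfolding eventually_at by blast
  show ?thesis
  \<comment> \<open>The bound 1 gives \<open>t - a \<le> 1\<close>, so the constant lower bound
    \<open>?m\<close> suffices. Halving \<open>e\<close> keeps the distance strictly below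
    \<open>e\<close>.\<close>
  proof (rule that[of ?m "min 1 (e / 2)"])
    fix t assume t: "t \<in> {a..b}" "t \<le> a + min 1 (e / 2)"
    show "?m * (t - a) \<le> direction (u a) (v a) * v t"
    proof (cases "t = a")
      case False
      have "?m * (t - a) \<le> ?m * 1"
        using t by (intro mult_left_mono) auto
      also have "\<dots> \<le> sgn (v a) * v t"
      proof -
        have "dist t a < e"
          using e(1) t by (auto simp: dist_real_def min_def split: if_splits)
        then show ?thesis
          using e(2)[of t] t False by simp
      qed
      finally show ?thesis
        using \<open>v a \<noteq> 0\<close> by (simp add: direction_def)
    qed (use \<open>v a \<noteq> 0\<close> in \<open>auto simp: direction_def sgn_if\<close>)
  qed (use False e in auto)
next
  case True
  then have "u a \<noteq> 0"
    using nz by simp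
  let ?k = "d * \<bar>signed_pow \<beta> (u a)\<bar>"
  have k: "?k > 0"
    using d \<open>u a \<noteq> 0\<close> by simp
  have sgn_eq: "sgn (u a) * signed_pow \<beta> (u a) = \<bar>signed_pow \<beta> (u a)\<bar>"
    by (cases "u a" "0::real" rule: linorder_cases) (simp_all add: signed_pow_def abs_mult)
  have "(v has_real_derivative accel (u a) (v a)) (at a within {a..b})"
    using sol \<open>a < b\<close> by (auto simp: solves_def)
  then have "((\<lambda>t. - sgn (u a) * v t) has_real_derivative - sgn (u a) * accel (u a) (v a)) (at a within {a..b})"
    by (rule DERIV_cmult)
  also have "- sgn (u a) * accel (u a) (v a) = ?k"
    using True sgn_eq by (simp add: accel_def algebra_simps)
  \<comment> \<open>As \<open>v a = 0\<close>, this quotient is the difference quotient at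
    \<open>a\<close>.\<close>
  finally have lim: "((\<lambda>t. - sgn (u a) * v t / (t - a)) \<longlongrightarrow> ?k) (at a within {a..b})"
    using True by (simp add: has_field_derivative_iff)
  have "\<forall>\<^sub>F t in at a within {a..b}. ?k / 2 < - sgn (u a) * v t / (t - a)"
    by (rule order_tendstoD(1)[OF lim]) (use k in auto)
  then obtain e where e: "e > 0"
    "\<And>t. t \<in> {a..b} \<Longrightarrow> t \<noteq> a \<Longrightarrow> dist t a < e \<Longrightarrow> ?k / 2 < - sgn (u a) * v t / (t - a)"
    unfolding eventually_at by blast
  show ?thesis
  proof (rule that[of "?k / 2" "e / 2"])
    fix t assume t: "t \<in> {a..b}" "t \<le> a + e / 2"
    show "?k / 2 * (t - a) \<le> direction (u a) (v a) * v t"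
    proof (cases "t = a")
      case False
      then have "?k / 2 < - sgn (u a) * v t / (t - a)" "t - a > 0"
        using e(2)[of t] e(1) t by (auto simp: dist_real_def)
      then have "?k / 2 * (t - a) < - sgn (u a) * v t"
        by (simp only: pos_less_divide_eq)
      then show ?thesis
        using True by (simp add: direction_def)
    qed (use True in auto)
  qed (use k e in auto)
qed

lemma abs_direction: "x \<noteq> 0 \<or> y \<noteq> 0 \<Longrightarrow> \<bar>direction x y\<bar> = 1"
  by (auto simp: direction_def sgn_if)

text \<open>Both \<open>g - f\<close> and \<open>g + f\<close> are nondecreasing. Asking for
  derivatives at interior points only admits \<open>(t - a) powr q\<close> as a comparison function,
  though for \<open>q < 1\<close> its derivative blows up at \<open>a\<close>.\<close>

lemma abs_le_of_deriv_le:
  fixes f g f' g' :: "real \<Rightarrow> real"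
  assumes "a \<le> b" "continuous_on {a..b} f" "continuous_on {a..b} g" "f a = 0" "g a = 0"
    and "\<And>t. a < t \<Longrightarrow> t < b \<Longrightarrow> DERIV f t :> f' t"
    and "\<And>t. a < t \<Longrightarrow> t < b \<Longrightarrow> DERIV g t :> g' t"
    and "\<And>t. a < t \<Longrightarrow> t < b \<Longrightarrow> \<bar>f' t\<bar> \<le> g' t"
  shows "\<bar>f b\<bar> \<le> g b"
proof -
  have "g a - f a \<le> g b - f b"
  proof (rule DERIV_nonneg_imp_increasing_open[OF \<open>a \<le> b\<close>])
    show "\<exists>y. DERIV (\<lambda>t. g t - f t) t :> y \<and> 0 \<le> y" if "a < t" "t < b" for t
      using assms(6-8)[OF that] by (intro exI[of _ "g' t - f' t"]) (auto intro: DERIV_diff)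
  qed (intro continuous_intros assms)
  moreover have "g a + f a \<le> g b + f b"
  proof (rule DERIV_nonneg_imp_increasing_open[OF \<open>a \<le> b\<close>])
    show "\<exists>y. DERIV (\<lambda>t. g t + f t) t :> y \<and> 0 \<le> y" if "a < t" "t < b" for t
      using assms(6-8)[OF that] by (intro exI[of _ "g' t + f' t"]) (auto intro: DERIV_add)
  qed (intro continuous_intros assms)
  ultimately show ?thesis
    using assms(4,5) by auto
qed

text \<open>The Gronwall argument takes the form of a contraction. With \<open>M\<close> the maximum
  of \<open>\<bar>v1 t - v2 t\<bar>\<close> on a short interval, integrating the first equation
  bounds the difference of \<open>u1\<close> and \<open>u2\<close> by \<open>C * M\<close>. The
  second equation then bounds that of \<open>v1\<close> and \<open>v2\<close> by
  \<open>M / 2\<close>, so \<open>M = 0\<close>.\<close>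

lemma local_uniqueness:
  assumes sol1: "solves {a..b} u1 v1" and sol2: "solves {a..b} u2 v2" and "a < b"
    and init: "u1 a = u2 a" "v1 a = v2 a"
  shows "\<exists>\<delta>>0. \<forall>t\<in>{a..b}. t \<le> a + \<delta> \<longrightarrow> u1 t = u2 t \<and> v1 t = v2 t"
proof (cases "u1 a = 0 \<and> v1 a = 0")
  case True
  have zero: "u t = 0 \<and> v t = 0" if "solves {a..b} u v" "u a = 0" "v a = 0" "t \<in> {a..b}" for u v t
  proof -
    have sol: "solves {a..t} u v"
      using that by (auto intro: solves_subset)
    have "energy (u t) (v t) \<le> energy (u a) (v a)"
      using that solves_imp_continuous_on[OF sol] solves_DERIV[OF sol]
      by (intro energy_decreasing) auto
    then have "energy (u t) (v t) = 0"
      using energy_nonneg[of "u t" "v t"] energy_eq_0_iff[of "u a" "v a"] that by simp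
    then show ?thesis
      by (simp add: energy_eq_0_iff)
  qed
  then show ?thesis
    using True init zero[OF sol1] zero[OF sol2] by (intro exI[of _ 1]) auto
next
  case False
  let ?\<sigma> = "direction (u1 a) (v1 a)"
  have \<sigma>: "\<bar>?\<sigma>\<bar> = 1"
    using False abs_direction by blast
  obtain m1 \<delta>1 where 1: "m1 > 0" "\<delta>1 > 0"
    "\<And>t. t \<in> {a..b} \<Longrightarrow> t \<le> a + \<delta>1 \<Longrightarrow> m1 * (t - a) \<le> ?\<sigma> * v1 t"
    using velocity_lower_bound[OF sol1 \<open>a < b\<close>] False by blast
  obtain m2 \<delta>2 where 2: "m2 > 0" "\<delta>2 > 0"
    "\<And>t. t \<in> {a..b} \<Longrightarrow> t \<le> a + \<delta>2 \<Longrightarrow> m2 * (t - a) \<le> ?\<sigma> * v2 t"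
    using velocity_lower_bound[OF sol2 \<open>a < b\<close>] False init by metis
  define m where "m = min m1 m2"
  have m: "m > 0"
    using 1 2 by (simp add: m_def)
  note cont = solves_imp_continuous_on[OF sol1] solves_imp_continuous_on[OF sol2]
  \<comment> \<open>The maximum of \<open>\<rho>\<close> bounds all four functions, so a single
    \<open>R\<close> serves for both Lipschitz constants.\<close>
  define \<rho> where "\<rho> t = max (max \<bar>u1 t\<bar> \<bar>v1 t\<bar>) (max \<bar>u2 t\<bar> \<bar>v2 t\<bar>)" for t
  have "continuous_on {a..b} \<rho>"
    unfolding \<rho>_def by (intro continuous_intros cont)
  then obtain r where "\<forall>t\<in>{a..b}. \<rho> t \<le> \<rho> r"
    using continuous_attains_sup[of "{a..b}" \<rho>] \<open>a < b\<close> by auto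
  then have \<rho>_le: "\<rho> t \<le> \<rho> r" if "t \<in> {a..b}" for t
    using that by blast
  define R where "R = \<rho> r"
  have R: "\<bar>u1 t\<bar> \<le> R" "\<bar>v1 t\<bar> \<le> R" "\<bar>u2 t\<bar> \<le> R" "\<bar>v2 t\<bar> \<le> R" if "t \<in> {a..b}" for t
    using \<rho>_le[OF that] by (simp_all add: R_def[symmetric] \<rho>_def[of t])
  obtain L1 where L1: "L1 \<ge> 0"
    "\<And>x y. \<bar>x\<bar> \<le> R \<Longrightarrow> \<bar>y\<bar> \<le> R \<Longrightarrow> \<bar>signed_pow \<gamma> x - signed_pow \<gamma> y\<bar> \<le> L1 * \<bar>x - y\<bar>"
    using signed_pow_lipschitz[OF \<gamma>] by blast
  obtain L2 where L2: "L2 \<ge> 0"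
    "\<And>x y. \<bar>x\<bar> \<le> R \<Longrightarrow> \<bar>y\<bar> \<le> R \<Longrightarrow> \<bar>signed_pow \<beta> x - signed_pow \<beta> y\<bar> \<le> L2 * \<bar>x - y\<bar>"
    using signed_pow_lipschitz[OF less_imp_le[OF \<beta>]] by blast
  \<comment> \<open>The constant part of \<open>(m * (s - a)) powr (q - 1)\<close>, the factor given
    by \<open>signed_pow_diff_le\<close>.\<close>
  define C where "C = m powr (q - 1)"
  \<comment> \<open>\<open>L * M\<close> will bound the derivative of \<open>v1 - v2\<close>. The
    summand 1 ensures \<open>L > 0\<close>, so that \<open>1 / (2 * L)\<close> is a positive
    length.\<close>
  define L where "L = c * L1 + d * (L2 * C) + 1"
  have C: "C \<ge> 0"
    by (simp add: C_def)
  have L: "L > 0"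
    unfolding L_def using c d L1 L2 C by (intro add_nonneg_pos add_nonneg_nonneg mult_nonneg_nonneg) auto
  \<comment> \<open>Besides keeping both lower bounds valid and staying inside
    \<open>{a..b}\<close>, this choice yields \<open>(t - a) powr q \<le> 1\<close> and the
    contraction factor \<open>L * \<delta> \<le> 1 / 2\<close>.\<close>
  define \<delta> where "\<delta> = min (min \<delta>1 \<delta>2) (min (min 1 (b - a)) (1 / (2 * L)))"
  have \<delta>: "\<delta> > 0" "\<delta> \<le> \<delta>1" "\<delta> \<le> \<delta>2" "\<delta> \<le> 1" "a + \<delta> \<le> b" "\<delta> \<le> 1 / (2 * L)"
    using 1 2 L \<open>a < b\<close> by (auto simp: \<delta>_def)
  have L\<delta>: "L * \<delta> \<le> 1 / 2"
    using \<delta>(6) L by (simp add: field_simps)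
  have sub: "{a..a + \<delta>} \<subseteq> {a..b}"
    using \<delta> by auto
  have "continuous_on {a..a + \<delta>} (\<lambda>t. \<bar>v1 t - v2 t\<bar>)"
    by (intro continuous_intros continuous_on_subset[OF _ sub] cont)
  moreover have "{a..a + \<delta>} \<noteq> {}"
    using \<delta>(1) by simp
  ultimately obtain t0 where t0: "t0 \<in> {a..a + \<delta>}"
    "\<And>t. t \<in> {a..a + \<delta>} \<Longrightarrow> \<bar>v1 t - v2 t\<bar> \<le> \<bar>v1 t0 - v2 t0\<bar>"
    using continuous_attains_sup[OF compact_Icc] by blast
  define M where "M = \<bar>v1 t0 - v2 t0\<bar>"
  have M: "M \<ge> 0"
    by (simp add: M_def)
  have u_diff: "\<bar>u1 t - u2 t\<bar> \<le> C * M" if t: "t \<in> {a..a + \<delta>}" for t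
  proof -
    \<comment> \<open>The right-hand side is the antiderivative of the singular bound
      \<open>C * M * (q * (s - a) powr (q - 1))\<close> that vanishes at \<open>a\<close>. It is
      finite because \<open>q > 0\<close>.\<close>
    have "\<bar>u1 t - u2 t\<bar> \<le> C * M * (t - a) powr q"
    proof (rule abs_le_of_deriv_le[where f = "\<lambda>t. u1 t - u2 t" and g = "\<lambda>t. C * M * (t - a) powr q"])
      show "a \<le> t"
        using t by simp
      have sub': "{a..t} \<subseteq> {a..b}"
        using t \<delta> by auto
      show "continuous_on {a..t} (\<lambda>t. u1 t - u2 t)"
        by (intro continuous_intros continuous_on_subset[OF _ sub'] cont)
      show "continuous_on {a..t} (\<lambda>t. C * M * (t - a) powr q)"
        using q by (intro continuous_intros continuous_on_powr') auto
      fix s assume s: "a < s" "s < t"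
      then have sb: "s < b" and s\<delta>: "s \<in> {a..a + \<delta>}" and sab: "s \<in> {a..b}"
        using t \<delta> by auto
      show "DERIV (\<lambda>t. u1 t - u2 t) s :> signed_pow (q - 1) (v1 s) - signed_pow (q - 1) (v2 s)"
        by (intro DERIV_diff solves_DERIV[OF sol1] solves_DERIV[OF sol2] s sb)
      have "DERIV (\<lambda>t. t - a) s :> 1"
        by (auto intro!: derivative_eq_intros)
      from DERIV_chain2[OF has_real_derivative_powr this, of q]
      have "DERIV (\<lambda>t. (t - a) powr q) s :> q * (s - a) powr (q - 1)"
        using s(1) by simp
      then show "DERIV (\<lambda>t. C * M * (t - a) powr q) s :> C * M * (q * (s - a) powr (q - 1))"
        by (rule DERIV_cmult)
      have "m * (s - a) \<le> ?\<sigma> * v1 s" "m * (s - a) \<le> ?\<sigma> * v2 s"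
      proof -
        have "m * (s - a) \<le> m1 * (s - a)" "m * (s - a) \<le> m2 * (s - a)"
          using s by (auto simp: m_def intro!: mult_right_mono)
        moreover have "m1 * (s - a) \<le> ?\<sigma> * v1 s" "m2 * (s - a) \<le> ?\<sigma> * v2 s"
          using 1(3)[OF sab] 2(3)[OF sab] s\<delta> \<delta> by auto
        ultimately show "m * (s - a) \<le> ?\<sigma> * v1 s" "m * (s - a) \<le> ?\<sigma> * v2 s"
          by linarith+
      qed
      then have "\<bar>signed_pow (q - 1) (v1 s) - signed_pow (q - 1) (v2 s)\<bar>
          \<le> q * (m * (s - a)) powr (q - 1) * \<bar>v1 s - v2 s\<bar>"
        using m s by (intro signed_pow_diff_le[OF \<sigma>]) auto
      also have "\<dots> \<le> q * (m * (s - a)) powr (q - 1) * M"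
        using t0(2)[OF s\<delta>] q by (intro mult_left_mono) (auto simp: M_def)
      also have "\<dots> = C * M * (q * (s - a) powr (q - 1))"
        using m s by (simp add: C_def powr_mult)
      finally show "\<bar>signed_pow (q - 1) (v1 s) - signed_pow (q - 1) (v2 s)\<bar> \<le>
          C * M * (q * (s - a) powr (q - 1))" .
    qed (use init in auto)
    also have "\<dots> \<le> C * M * 1"
    proof (rule mult_left_mono)
      show "(t - a) powr q \<le> 1"
        using t \<delta> q by (intro powr_le1) auto
    qed (use C M in auto)
    finally show ?thesis by simp
  qed
  have v_diff: "\<bar>v1 t - v2 t\<bar> \<le> L * M * (t - a)" if t: "t \<in> {a..a + \<delta>}" for t
  proof (rule abs_le_of_deriv_le[where f = "\<lambda>t. v1 t - v2 t" and g = "\<lambda>t. L * M * (t - a)"])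
    show "a \<le> t"
      using t by simp
    have sub': "{a..t} \<subseteq> {a..b}"
      using t \<delta> by auto
    show "continuous_on {a..t} (\<lambda>t. v1 t - v2 t)"
      by (intro continuous_intros continuous_on_subset[OF _ sub'] cont)
    fix s assume s: "a < s" "s < t"
    then have sb: "s < b" and s\<delta>: "s \<in> {a..a + \<delta>}" and sab: "s \<in> {a..b}"
      using t \<delta> by auto
    show "DERIV (\<lambda>t. v1 t - v2 t) s :> accel (u1 s) (v1 s) - accel (u2 s) (v2 s)"
      by (intro DERIV_diff solves_DERIV[OF sol1] solves_DERIV[OF sol2] s sb)
    show "DERIV (\<lambda>t. L * M * (t - a)) s :> L * M"
      by (auto intro!: derivative_eq_intros)
    have "\<bar>accel (u1 s) (v1 s) - accel (u2 s) (v2 s)\<bar> =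
        \<bar>c * (signed_pow \<gamma> (v1 s) - signed_pow \<gamma> (v2 s)) + d * (signed_pow \<beta> (u1 s) - signed_pow \<beta> (u2 s))\<bar>"
      by (simp add: accel_def algebra_simps)
    also have "\<dots> \<le> c * \<bar>signed_pow \<gamma> (v1 s) - signed_pow \<gamma> (v2 s)\<bar> + d * \<bar>signed_pow \<beta> (u1 s) - signed_pow \<beta> (u2 s)\<bar>"
      using c d abs_triangle_ineq by (metis abs_mult abs_of_pos)
    also have "\<dots> \<le> c * (L1 * M) + d * (L2 * (C * M))"
    proof (intro add_mono mult_left_mono)
      have "L1 * \<bar>v1 s - v2 s\<bar> \<le> L1 * M"
        using t0(2)[OF s\<delta>] L1 by (intro mult_left_mono) (auto simp: M_def)
      then show "\<bar>signed_pow \<gamma> (v1 s) - signed_pow \<gamma> (v2 s)\<bar> \<le> L1 * M"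
        using L1(2) R[OF sab] order_trans by blast
      have "L2 * \<bar>u1 s - u2 s\<bar> \<le> L2 * (C * M)"
        using u_diff[OF s\<delta>] L2 by (intro mult_left_mono) auto
      then show "\<bar>signed_pow \<beta> (u1 s) - signed_pow \<beta> (u2 s)\<bar> \<le> L2 * (C * M)"
        using L2(2) R[OF sab] order_trans by blast
    qed (use c d in auto)
    also have "\<dots> \<le> L * M"
      using M by (simp add: L_def algebra_simps)
    finally show "\<bar>accel (u1 s) (v1 s) - accel (u2 s) (v2 s)\<bar> \<le> L * M" .
  qed (use init in \<open>auto intro!: continuous_intros\<close>)
  have "M \<le> L * M * (t0 - a)"
    using v_diff[OF t0(1)] by (simp add: M_def)
  also have "\<dots> \<le> L * M * \<delta>"
    using t0(1) L M by (intro mult_left_mono) auto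
  also have "\<dots> = (L * \<delta>) * M"
    by simp
  also have "\<dots> \<le> 1 / 2 * M"
    using L\<delta> M by (intro mult_right_mono) auto
  finally have "M = 0"
    using M by simp
  then show ?thesis
    using \<delta> u_diff v_diff by (intro exI[of _ \<delta>]) force
qed

text \<open>Continuation: at the infimum \<open>s\<close> of the times of disagreement the solutions
  still agree, and local uniqueness from \<open>s\<close> on carries the agreement past
  \<open>s\<close>, a contradiction.\<close>

theorem uniqueness:
  assumes sol1: "solves {a..b} u1 v1" and sol2: "solves {a..b} u2 v2"
    and init: "u1 a = u2 a" "v1 a = v2 a" and t: "t \<in> {a..b}"
  shows "u1 t = u2 t \<and> v1 t = v2 t"
proof (rule ccontr)
  define Z where "Z = {t \<in> {a..b}. u1 t - u2 t = 0} \<inter> {t \<in> {a..b}. v1 t - v2 t = 0}"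
  define D where "D = {a..b} - Z"
  note cont = solves_imp_continuous_on[OF sol1] solves_imp_continuous_on[OF sol2]
  assume "\<not> (u1 t = u2 t \<and> v1 t = v2 t)"
  then have "t \<in> D"
    using t by (auto simp: D_def Z_def)
  have closed: "closed Z"
    unfolding Z_def
    by (intro closed_Int continuous_closed_preimage_constant continuous_intros cont closed_atLeastAtMost)
  define s where "s = Inf D"
  have bdd: "bdd_below D"
    unfolding D_def by (rule bdd_belowI[of _ a]) auto
  have s_le: "s \<le> x" if "x \<in> D" for x
    unfolding s_def using that bdd by (rule cInf_lower)
  have "a \<le> s"
    unfolding s_def using \<open>t \<in> D\<close> by (intro cInf_greatest) (auto simp: D_def)
  have "s \<le> b"
    using s_le[OF \<open>t \<in> D\<close>] t by simp
  have below: "{a..<s} \<subseteq> Z"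
    using s_le \<open>s \<le> b\<close> by (force simp: D_def)
  \<comment> \<open>For \<open>s = a\<close> this is the initial condition, since
    \<open>{a..<s}\<close> is then empty. Otherwise \<open>s\<close> is a limit of times of
    agreement and \<open>Z\<close> is closed.\<close>
  have "s \<in> Z"
  proof (cases "a = s")
    case True
    then show ?thesis
      using init \<open>s \<le> b\<close> by (auto simp: Z_def)
  next
    case False
    then have "s \<in> closure {a..<s}"
      using \<open>a \<le> s\<close> by (simp add: closure_atLeastLessThan)
    then show ?thesis
      using closure_minimal[OF below closed] by blast
  qed
  then have "s \<noteq> t"
    using \<open>t \<in> D\<close> by (auto simp: D_def)
  then have "s < b"
    using s_le[OF \<open>t \<in> D\<close>] t by simp
  then obtain \<delta> where \<delta>: "\<delta> > 0" "\<And>x. x \<in> {s..b} \<Longrightarrow> x \<le> s + \<delta> \<Longrightarrow> u1 x = u2 x \<and> v1 x = v2 x"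
    using local_uniqueness[OF solves_subset[OF sol1] solves_subset[OF sol2], of s b] \<open>s \<in> Z\<close> \<open>a \<le> s\<close>
    by (auto simp: Z_def)
  have "s + \<delta> \<le> x" if "x \<in> D" for x
    using \<delta>(2)[of x] s_le[OF that] that by (force simp: D_def Z_def)
  then have "s + \<delta> \<le> s"
    unfolding s_def using \<open>t \<in> D\<close> by (intro cInf_greatest) auto
  then show False
    using \<delta> by simp
qed

section \<open>Global existence\<close>

text \<open>Both terms of the energy are nonnegative and each tends to infinity with its argument,
  so either one alone exceeds the level \<open>e\<close> outside the box.\<close>

lemma energy_sublevel_bounded:
  obtains R where "R > 0" "\<And>x y. energy x y \<le> e \<Longrightarrow> \<bar>x\<bar> < R \<and> \<bar>y\<bar> < R"
proof -
  have ev: "\<forall>\<^sub>F R in at_top. e < K * R powr r" if "K > 0" "r > 0" for K r :: real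
  proof -
    have "filterlim (\<lambda>R::real. K * R powr r) at_top at_top"
      using that by real_asymp
    then show ?thesis
      by (simp add: filterlim_at_top_dense)
  qed
  have "\<forall>\<^sub>F R in at_top. e < 1 / (q + 1) * R powr (q + 1)" "\<forall>\<^sub>F R in at_top. e < d / (\<beta> + 2) * R powr (\<beta> + 2)"
    by (rule ev; use q \<beta> d in simp)+
  then have "\<forall>\<^sub>F R in at_top. R > 0 \<and> e < 1 / (q + 1) * R powr (q + 1) \<and> e < d / (\<beta> + 2) * R powr (\<beta> + 2)"
    using eventually_gt_at_top[of 0] by eventually_elim auto
  then obtain R where R: "R > 0" "e < 1 / (q + 1) * R powr (q + 1)" "e < d / (\<beta> + 2) * R powr (\<beta> + 2)"
    using eventually_happens'[OF trivial_limit_at_top_linorder] by blast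
  show ?thesis
  proof (rule that[OF R(1)], rule ccontr)
    fix x y assume E: "energy x y \<le> e" and "\<not> (\<bar>x\<bar> < R \<and> \<bar>y\<bar> < R)"
    then consider "R \<le> \<bar>x\<bar>" | "R \<le> \<bar>y\<bar>"
      by linarith
    then show False
    proof cases
      case 1
      have "d / (\<beta> + 2) * R powr (\<beta> + 2) \<le> d / (\<beta> + 2) * \<bar>x\<bar> powr (\<beta> + 2)"
        using 1 R \<beta> d by (intro mult_left_mono powr_mono2) auto
      also have "\<dots> \<le> energy x y"
        using q by (simp add: energy_def)
      finally show False
        using E R by linarith
    next
      case 2
      have "1 / (q + 1) * R powr (q + 1) \<le> 1 / (q + 1) * \<bar>y\<bar> powr (q + 1)"
        using 2 R q by (intro mult_left_mono powr_mono2) auto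
      also have "\<dots> \<le> energy x y"
        using \<beta> d by (simp add: energy_def)
      finally show False
        using E R by linarith
    qed
  qed
qed

text \<open>Clamping both arguments to \<open>[-R, R]\<close> makes the field bounded, so Peano's
  theorem applies. With \<open>R\<close> taken from the initial energy level, the clamp
  \<open>\<tau>\<close> is never active along the solution.\<close>

theorem existence_interval:
  assumes T: "T \<ge> 0"
  obtains u v where "solves {0..T} u v" "u 0 = x0" "v 0 = y0"
proof -
  obtain R where R: "R > 0" "\<And>x y. energy x y \<le> energy x0 y0 \<Longrightarrow> \<bar>x\<bar> < R \<and> \<bar>y\<bar> < R"
    using energy_sublevel_bounded by blast
  define \<tau> where "\<tau> x = max (- R) (min R x)" for x
  have \<tau>_eq: "\<tau> x = x" if "\<bar>x\<bar> < R" for x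
    using that by (auto simp: \<tau>_def)
  have \<tau>_range: "\<tau> x \<in> {- R..R}" for x
    using R by (auto simp: \<tau>_def)
  define G :: "real \<times> real \<Rightarrow> real \<times> real"
    where "G p = (signed_pow (q - 1) (snd p), accel (fst p) (snd p))" for p
  have G_cont: "continuous_on A G" for A
    unfolding G_def[abs_def] accel_def using q \<gamma> \<beta>
    by (intro continuous_intros) auto
  define F where "F p = G (\<tau> (fst p), \<tau> (snd p))" for p
  have F_cont: "continuous_on UNIV F"
    unfolding F_def[abs_def] \<tau>_def
    by (intro continuous_on_compose2[OF G_cont[of UNIV], where f = "\<lambda>p. (max (- R) (min R (fst p)), max (- R) (min R (snd p)))"]
        continuous_intros) auto
  have "bounded (G ` ({- R..R} \<times> {- R..R}))"
    by (rule compact_imp_bounded[OF compact_continuous_image[OF G_cont compact_Times[OF compact_Icc compact_Icc]]])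
  then obtain B where B: "\<forall>x \<in> G ` ({- R..R} \<times> {- R..R}). norm x \<le> B"
    unfolding bounded_iff ..
  have F_bound: "norm (F p) \<le> B" for p
  proof -
    have "F p \<in> G ` ({- R..R} \<times> {- R..R})"
      unfolding F_def using \<tau>_range by (intro imageI) (simp only: mem_Times_iff fst_conv snd_conv)
    then show ?thesis
      using B by (rule bspec[rotated])
  qed
  obtain z where z0: "z 0 = (x0, y0)"
    and z: "\<And>t. t \<in> {0..T} \<Longrightarrow> (z has_vector_derivative F (z t)) (at t within {0..T})"
    using peano_bounded[OF F_cont F_bound T] by metis
  define u v where "u t = fst (z t)" and "v t = snd (z t)" for t
  have du: "(u has_real_derivative signed_pow (q - 1) (\<tau> (v t))) (at t within {0..T})"
    and dv: "(v has_real_derivative accel (\<tau> (u t)) (\<tau> (v t))) (at t within {0..T})"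
    if "t \<in> {0..T}" for t
    using bounded_linear.has_vector_derivative[OF bounded_linear_fst z[OF that]]
      bounded_linear.has_vector_derivative[OF bounded_linear_snd z[OF that]]
    by (auto simp: u_def[abs_def] v_def[abs_def] F_def G_def has_real_derivative_iff_has_vector_derivative)
  have cont: "continuous_on {0..T} u" "continuous_on {0..T} v"
    by (rule DERIV_continuous_on, erule du) (rule DERIV_continuous_on, erule dv)
  have inside: "\<bar>u t\<bar> < R \<and> \<bar>v t\<bar> < R" if t: "t \<in> {0..T}" for t
  proof (rule ccontr)
    define D where "D = {t \<in> {0..T}. \<bar>u t\<bar> \<in> {R..}} \<union> {t \<in> {0..T}. \<bar>v t\<bar> \<in> {R..}}"
    assume "\<not> ?thesis"
    then have "t \<in> D"
      using t by (auto simp: D_def)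
    have "closed ({0..T} \<inter> (\<lambda>t. \<bar>u t\<bar>) -` {R..})" "closed ({0..T} \<inter> (\<lambda>t. \<bar>v t\<bar>) -` {R..})"
      by (intro continuous_closed_preimage continuous_intros cont closed_atLeastAtMost closed_atLeast)+
    moreover have "D = ({0..T} \<inter> (\<lambda>t. \<bar>u t\<bar>) -` {R..}) \<union> ({0..T} \<inter> (\<lambda>t. \<bar>v t\<bar>) -` {R..})"
      by (auto simp: D_def)
    ultimately have closed: "closed D"
      by (simp add: closed_Un)
    have bdd: "bdd_below D"
      unfolding D_def by (rule bdd_belowI[of _ 0]) auto
    \<comment> \<open>The first time outside the open box, attained because \<open>D\<close> is
      closed. Before \<open>s\<close> the clamp is the identity, so the energy estimate holds up to
      \<open>s\<close> and puts the state at \<open>s\<close> back strictly inside the box.\<close>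
    define s where "s = Inf D"
    have s: "s \<in> D"
      unfolding s_def using \<open>t \<in> D\<close> bdd closed by (intro closed_contains_Inf) auto
    then have sT: "s \<in> {0..T}"
      by (auto simp: D_def)
    have in_box: "\<bar>u r\<bar> < R" "\<bar>v r\<bar> < R" if "0 < r" "r < s" for r
      using cInf_lower[OF _ bdd, of r] that sT by (force simp: D_def s_def)+
    have "energy (u s) (v s) \<le> energy (u 0) (v 0)"
    proof (rule energy_decreasing)
      show "continuous_on {0..s} u" "continuous_on {0..s} v"
        using cont sT by (auto intro: continuous_on_subset)
      fix r assume r: "0 < r" "r < s"
      then have "at r within {0..T} = at r"
        using sT by (intro at_within_Icc_at) auto
      then show "DERIV u r :> signed_pow (q - 1) (v r)" "DERIV v r :> accel (u r) (v r)"
        using du[of r] dv[of r] r sT in_box[OF r] by (auto simp: \<tau>_eq)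
    qed (use sT in auto)
    then have "\<bar>u s\<bar> < R \<and> \<bar>v s\<bar> < R"
      using R(2) by (simp add: u_def v_def z0)
    then show False
      using s by (auto simp: D_def)
  qed
  show ?thesis
  proof (rule that)
    show "solves {0..T} u v"
      unfolding solves_def using du dv inside by (auto simp: \<tau>_eq)
  qed (simp_all add: u_def v_def z0)
qed

text \<open>Solutions on the intervals \<open>[0, n]\<close> are chosen independently and glued. By
  uniqueness any two agree where both are defined.\<close>

theorem existence_halfline:
  obtains u v where "solves {0..} u v" "u 0 = x0" "v 0 = y0"
proof -
  have "\<forall>n::nat. \<exists>u v. solves {0..real n} u v \<and> u 0 = x0 \<and> v 0 = y0"
    using existence_interval by (metis of_nat_0_le_iff)
  then obtain U V where UV: "\<And>n::nat. solves {0..real n} (U n) (V n)"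
    and init: "\<And>n. U n 0 = x0" "\<And>n. V n 0 = y0"
    by metis
  \<comment> \<open>\<open>Suc\<close> makes \<open>t < N t\<close> strict, so
    \<open>{0..N t}\<close> contains a neighbourhood of \<open>t\<close> relative to
    \<open>{0..}\<close> and derivatives within the two sets coincide.\<close>
  define N where "N t = Suc (nat \<lceil>t\<rceil>)" for t :: real
  have N: "t < real (N t)" for t
    unfolding N_def by linarith
  define u v where "u t = U (N t) t" and "v t = V (N t) t" for t
  have eq: "u t = U n t \<and> v t = V n t" if "t \<in> {0..real n}" for t n
  proof -
    have "solves {0..t} (U (N t)) (V (N t))" "solves {0..t} (U n) (V n)"
      using that N[of t] by (auto intro!: solves_subset[OF UV])
    from uniqueness[OF this] show ?thesis
      using that init by (simp add: u_def v_def)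
  qed
  show ?thesis
  proof (rule that)
    show "solves {0..} u v"
      unfolding solves_def
    proof (intro ballI conjI)
      fix t :: real assume t: "t \<in> {0..}"
      let ?n = "N t"
      have tn: "t \<in> {0..real ?n}"
        using t N[of t] by simp
      have at_eq: "at t within {0..} = at t within {0..real ?n}"
        using t N[of t] by (intro at_within_nhd[of t "{..<real ?n}"]) auto
      have "(U ?n has_real_derivative signed_pow (q - 1) (V ?n t)) (at t within {0..real ?n})"
        "(V ?n has_real_derivative accel (U ?n t) (V ?n t)) (at t within {0..real ?n})"
        using UV[of ?n] tn by (auto simp: solves_def)
      then have "(u has_real_derivative signed_pow (q - 1) (V ?n t)) (at t within {0..real ?n})"
        "(v has_real_derivative accel (U ?n t) (V ?n t)) (at t within {0..real ?n})"
        using eq has_field_derivative_transform_within[OF _ zero_less_one tn] by metis+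
      then show "(u has_real_derivative signed_pow (q - 1) (v t)) (at t within {0..})"
        "(v has_real_derivative accel (u t) (v t)) (at t within {0..})"
        unfolding at_eq u_def[of t] v_def[of t] by this+
    qed
  qed (simp_all add: u_def v_def init)
qed

end

section \<open>Return to the second-order equation\<close>

text \<open>Identifying the derivative selected by \<open>deriv_on\<close> requires its uniqueness,
  that is, a nontrivial filter \<open>at t within {0..}\<close>. Right neighbourhoods of
  \<open>t\<close> provide this, also at 0.\<close>

lemma deriv_on_halfline_eq:
  assumes "(f has_real_derivative D) (at t within {0..})" "t \<ge> 0"
  shows "deriv_on {0..} f t = D"
proof -
  have "at_right t \<le> at t within {0..}"
    using assms(2) by (intro at_le) auto
  then have "at t within {0..} \<noteq> bot"
    using trivial_limit_at_right_real[of t] by (auto simp: bot_unique)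
  then show ?thesis
    using assms(1) by (simp add: deriv_on_def has_real_derivative_iff_has_vector_derivative vector_derivative_within)
qed

lemma has_real_derivative_deriv_on:
  assumes "f differentiable_on S" "t \<in> S"
  shows "(f has_real_derivative deriv_on S f t) (at t within S)"
proof -
  have "f differentiable (at t within S)"
    using assms by (simp add: differentiable_on_def)
  then show ?thesis
    by (simp only: deriv_on_def has_real_derivative_iff_has_vector_derivative vector_derivative_works)
qed

theorem theorem2p8:
  fixes \<alpha> \<beta> c d l u0 u1 :: real
  assumes "\<alpha> > 0" and "\<beta> > 0" and "c > 0" and "d > 0"
    and "l \<ge> 0" and "l \<le> min \<alpha> \<beta>"
  shows "\<exists>u. is_ivp_solution l \<alpha> \<beta> c d u0 u1 u \<and>
             (\<forall>w. is_ivp_solution l \<alpha> \<beta> c d u0 u1 w \<longrightarrow> (\<forall>t\<in>{0..}. w t = u t))"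
proof -
  define q where "q = 1 / (l + 1)"
  \<comment> \<open>Since \<open>\<gamma> + 1 = (\<alpha> + 1) / (l + 1)\<close>, the damping term
    becomes \<open>c * signed_pow \<gamma> v\<close>. The hypothesis \<open>l \<le> \<alpha>\<close>
    gives \<open>\<gamma> \<ge> 0\<close>, hence a Lipschitz damping on bounded sets.\<close>
  define \<gamma> where "\<gamma> = (\<alpha> + 1) * q - 1"
  have ql: "q * (l + 1) = 1" and "0 < q" "q \<le> 1"
    using assms by (simp_all add: q_def)
  have "0 \<le> \<gamma>"
    using mult_left_mono[of "l + 1" "\<alpha> + 1" q] ql \<open>0 < q\<close> assms by (simp add: \<gamma>_def mult.commute)
  interpret damped_system q \<gamma> \<beta> c d
    using assms \<open>0 < q\<close> \<open>q \<le> 1\<close> \<open>0 \<le> \<gamma>\<close> by unfold_locales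
  have inv1: "signed_pow (q - 1) (signed_pow l x) = x" for x
    by (simp add: signed_pow_signed_pow ql)
  have inv2: "signed_pow l (signed_pow (q - 1) x) = x" for x
    using ql by (simp add: signed_pow_signed_pow mult.commute)
  have damp: "signed_pow \<alpha> (signed_pow (q - 1) x) = signed_pow \<gamma> x" for x
    by (simp add: signed_pow_signed_pow \<gamma>_def)
  obtain u v where uv: "solves {0..} u v" "u 0 = u0" "v 0 = signed_pow l u1"
    using existence_halfline by blast
  have cont: "continuous_on {0..} u" "continuous_on {0..} v"
    using solves_imp_continuous_on[OF uv(1)] .
  have du: "deriv_on {0..} u t = signed_pow (q - 1) (v t)" if "t \<ge> 0" for t
    using uv(1) that by (intro deriv_on_halfline_eq) (auto simp: solves_def)
  let ?w = "\<lambda>t. signed_pow l (deriv_on {0..} u t)"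
  have w_eq: "?w t = v t" if "t \<ge> 0" for t
    using du[OF that] inv2 by simp
  have w_deriv: "(?w has_real_derivative accel (u t) (v t)) (at t within {0..})" if "t \<ge> 0" for t
    by (rule has_field_derivative_transform_within[OF _ zero_less_one, where f = v])
      (use uv(1) w_eq that in \<open>auto simp: solves_def\<close>)
  have dw: "deriv_on {0..} ?w t = accel (u t) (v t)" if "t \<ge> 0" for t
    using w_deriv[OF that] that by (rule deriv_on_halfline_eq)
  have "is_ivp_solution l \<alpha> \<beta> c d u0 u1 u"
    unfolding is_ivp_solution_def is_solution_def C1_on_def
  proof (intro conjI ballI)
    show "u differentiable_on {0..}"
      using uv(1) unfolding solves_def differentiable_on_def
      by (meson field_differentiable_def field_differentiable_imp_differentiable)
    show "?w differentiable_on {0..}"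
      using w_deriv unfolding differentiable_on_def
      by (meson atLeast_iff field_differentiable_def field_differentiable_imp_differentiable)
    have "continuous_on {0..} (\<lambda>t. signed_pow (q - 1) (v t))"
      using q by (intro continuous_intros cont) auto
    then show "continuous_on {0..} (deriv_on {0..} u)"
      using du by (subst continuous_on_cong[OF refl]) auto
    have "continuous_on {0..} (\<lambda>t. accel (u t) (v t))"
      unfolding accel_def using \<gamma> \<beta>
      by (intro continuous_intros cont) auto
    then show "continuous_on {0..} (deriv_on {0..} ?w)"
      using dw by (subst continuous_on_cong[OF refl]) auto
    show "u 0 = u0"
      by (rule uv)
    show "deriv_on {0..} u 0 = u1"
      using du[of 0] uv inv1 by simp
    show "deriv_on {0..} ?w t + c * signed_pow \<alpha> (deriv_on {0..} u t) + d * signed_pow \<beta> (u t) = 0"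
      if "t \<in> {0..}" for t
      using that by (simp add: dw du damp accel_def)
  qed
  moreover have "w t = u t" if w: "is_ivp_solution l \<alpha> \<beta> c d u0 u1 w" and t: "t \<ge> 0" for w t
  proof -
    \<comment> \<open>Conversely, any solution \<open>w\<close> paired with \<open>?z\<close> solves
      the first-order system with the same initial data, so uniqueness for the system
      applies.\<close>
    let ?z = "\<lambda>t. signed_pow l (deriv_on {0..} w t)"
    have "solves {0..} w ?z"
      unfolding solves_def
    proof (intro ballI conjI)
      fix s :: real assume s: "s \<in> {0..}"
      show "(w has_real_derivative signed_pow (q - 1) (?z s)) (at s within {0..})"
        using has_real_derivative_deriv_on[of w "{0..}" s] w s
        by (simp add: inv1 is_ivp_solution_def is_solution_def C1_on_def)
      have "deriv_on {0..} ?z s = accel (w s) (?z s)"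
      proof -
        have "deriv_on {0..} ?z s + c * signed_pow \<alpha> (deriv_on {0..} w s) + d * signed_pow \<beta> (w s) = 0"
          using w s by (simp add: is_ivp_solution_def is_solution_def)
        moreover have "signed_pow \<alpha> (deriv_on {0..} w s) = signed_pow \<gamma> (?z s)"
          using damp[of "?z s"] by (simp only: inv1)
        ultimately show ?thesis
          by (simp only: accel_def)
      qed
      then show "(?z has_real_derivative accel (w s) (?z s)) (at s within {0..})"
        using has_real_derivative_deriv_on[of ?z "{0..}" s] w s
        by (simp add: is_ivp_solution_def is_solution_def C1_on_def)
    qed
    then have "solves {0..t} w ?z" "solves {0..t} u v"
      using uv(1) by (auto intro: solves_subset)
    from uniqueness[OF this, of t] show ?thesis
      using w t uv by (simp add: is_ivp_solution_def)
  qed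
  ultimately show ?thesis
    by auto
qed

end
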